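(* For every integer $n\ge 1$, the Stone–Čech compactification of $\mathcal{L}_+^n$ is $\bar{\mathcal{L}}_+^n$ and the Stone–Čech compactification of $\mathcal{L}^n$ is $\bar{\mathcal{L}}^n$ (where the canonical maps are the inclusions $\mathcal{L}_+^n\hookrightarrow \bar{\mathcal{L}}_+^n$ and $\mathcal{L}^n\hookrightarrow\bar{\mathcal{L}}^n$).
   Context: Let $\Omega$ be the smallest uncountable ordinal and $S_\Omega$ the set of all ordinals less than $\Omega$. The semi-closed half-long line $\mathcal{L}_+$ is the set $S_\Omega\times[0,1)$ with the lexicographic order (the ordinal being the leading coordinate) and the order topology; its smallest element is denoted $0$. Let $\mathcal{L}_-$ be $\mathcal{L}_+$ with its order reversed. The long line $\mathcal{L}$ is the linearly ordered space $\mathcal{L}_-\cup\mathcal{L}_+$, with the two copies of $0$ identified ($\mathcal{L}_-$ lying below $\mathcal{L}_+$), with the order topology. The extended half-long line is $\bar{\mathcal{L}}_+=\mathcal{L}_+\cup\{\Omega\}$, with $\Omega$ added as largest element, and the extended long line is $\bar{\mathcal{L}}=\mathcal{L}\cup\{-\Omega,\Omega\}$, with $\Omega$ added as largest and $-\Omega$ as smallest element; both carry the order topology. Powers $X^n$ carry the product topology. *)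

theory Defs
  imports "HOL-Analysis.Analysis"
begin

section \<open>The countable ordinals\<close>

text \<open>
  \<open>cardSuc natLeq\<close> is an initial well-order of cardinality \<open>\<aleph>\<^sub>1\<close>, i.e. it has order type
  \<open>\<Omega>\<close>; so its field, with that order, is a copy of the set \<open>S\<^sub>\<Omega>\<close> of ordinals below \<open>\<Omega>\<close>.  The
  lemmas \<open>uncountable_UNIV_ctbl_ord\<close> and \<open>countable_lessThan_ctbl_ord\<close> below say exactly this.
\<close>

unbundle cardinal_syntax

lemma Card_order_cardSuc_natLeq: "Card_order (cardSuc natLeq)"
  by (rule cardSuc_Card_order[OF natLeq_Card_order])

lemma Well_order_cardSuc_natLeq: "Well_order (cardSuc natLeq)"
  using Card_order_cardSuc_natLeq by (simp add: card_order_on_def)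

lemma uncountable_Field_cardSuc_natLeq: "uncountable (Field (cardSuc natLeq))"
proof
  assume "countable (Field (cardSuc natLeq))"
  then have "|Field (cardSuc natLeq)| \<le>o |UNIV :: nat set|"
    unfolding countable_def by (auto simp: card_of_ordLeq[symmetric])
  then have "cardSuc natLeq \<le>o natLeq"
    using card_of_Field_ordIso[OF Card_order_cardSuc_natLeq] card_of_nat
    by (meson ordIso_symmetric ordIso_ordLeq_trans ordLeq_ordIso_trans)
  then show False
    using cardSuc_greater[OF natLeq_Card_order] not_ordLess_ordLeq by blast
qed

lemma countable_underS_cardSuc_natLeq:
  assumes "a \<in> Field (cardSuc natLeq)"
  shows "countable (underS (cardSuc natLeq) a)"
proof -
  have "|underS (cardSuc natLeq) a| <o cardSuc natLeq"
    by (rule card_of_underS[OF Card_order_cardSuc_natLeq assms])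
  then have "|underS (cardSuc natLeq) a| \<le>o natLeq"
    using cardSuc_ordLeq_ordLess[OF natLeq_Card_order card_of_Card_order] by blast
  then have "|underS (cardSuc natLeq) a| \<le>o |UNIV :: nat set|"
    using card_of_nat ordIso_symmetric ordLeq_ordIso_trans by blast
  then show ?thesis
    unfolding countable_def by (auto simp: card_of_ordLeq[symmetric])
qed

typedef ctbl_ord = "Field (cardSuc natLeq)"
  using uncountable_Field_cardSuc_natLeq by (metis countable_empty ex_in_conv)

instantiation ctbl_ord :: linorder
begin

definition less_eq_ctbl_ord :: "ctbl_ord \<Rightarrow> ctbl_ord \<Rightarrow> bool" where
  "a \<le> b \<longleftrightarrow> (Rep_ctbl_ord a, Rep_ctbl_ord b) \<in> cardSuc natLeq"

definition less_ctbl_ord :: "ctbl_ord \<Rightarrow> ctbl_ord \<Rightarrow> bool" where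
  "(a :: ctbl_ord) < b \<longleftrightarrow> a \<le> b \<and> \<not> b \<le> a"

instance
proof
  let ?r = "cardSuc natLeq"
  have W: "refl_on (Field ?r) ?r" "trans ?r" "antisym ?r" "total_on (Field ?r) ?r"
    using Well_order_cardSuc_natLeq
    by (auto simp: well_order_on_def linear_order_on_def partial_order_on_def preorder_on_def)
  fix x y z :: ctbl_ord
  show "(x < y) = (x \<le> y \<and> \<not> y \<le> x)" by (rule less_ctbl_ord_def)
  show "x \<le> x"
    unfolding less_eq_ctbl_ord_def using W(1) Rep_ctbl_ord by (meson refl_onD)
  show "x \<le> y \<Longrightarrow> y \<le> z \<Longrightarrow> x \<le> z"
    unfolding less_eq_ctbl_ord_def using W(2) by (meson transD)
  show anti: "x \<le> y \<Longrightarrow> y \<le> x \<Longrightarrow> x = y" for x y :: ctbl_ord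
    unfolding less_eq_ctbl_ord_def using W(3) Rep_ctbl_ord_inject by (meson antisymD)
  show "x \<le> y \<or> y \<le> x"
    unfolding less_eq_ctbl_ord_def
    using W(1,4) Rep_ctbl_ord by (metis refl_onD total_on_def)
qed

end

instance ctbl_ord :: wellorder
proof
  let ?r = "cardSuc natLeq"
  have wf: "wf (?r - Id)"
    using Well_order_cardSuc_natLeq by (simp add: well_order_on_def)
  fix P :: "ctbl_ord \<Rightarrow> bool" and a
  assume step: "\<And>x. (\<And>y. y < x \<Longrightarrow> P y) \<Longrightarrow> P x"
  have "\<forall>x. Rep_ctbl_ord x = u \<longrightarrow> P x" for u
  proof (induction u rule: wf_induct_rule[OF wf])
    case (1 u)
    show ?case
    proof (intro allI impI)
      fix x assume x: "Rep_ctbl_ord x = u"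
      show "P x"
      proof (rule step)
        fix y assume y: "y < x"
        then have "y \<le> x" "y \<noteq> x" by (auto simp: less_ctbl_ord_def)
        then have "(Rep_ctbl_ord y, u) \<in> ?r - Id"
          using x by (auto simp: less_eq_ctbl_ord_def Rep_ctbl_ord_inject)
        then show "P y" using 1 by blast
      qed
    qed
  qed
  then show "P a" by blast
qed

lemma uncountable_UNIV_ctbl_ord: "uncountable (UNIV :: ctbl_ord set)"
proof
  assume "countable (UNIV :: ctbl_ord set)"
  then have "countable (range Rep_ctbl_ord)" by (rule countable_image)
  then show False
    using uncountable_Field_cardSuc_natLeq type_definition.Rep_range[OF type_definition_ctbl_ord]
    by simp
qed

lemma countable_lessThan_ctbl_ord: "countable {..<a :: ctbl_ord}"
proof -
  have "Rep_ctbl_ord ` {..<a} \<subseteq> underS (cardSuc natLeq) (Rep_ctbl_ord a)"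
    by (auto simp: underS_def less_le less_eq_ctbl_ord_def Rep_ctbl_ord_inject)
  then have "countable (Rep_ctbl_ord ` {..<a})"
    using countable_underS_cardSuc_natLeq[OF Rep_ctbl_ord] countable_subset by blast
  then show ?thesis
    by (rule countable_image_inj_on) (auto simp: inj_on_def Rep_ctbl_ord_inject)
qed


unbundle no cardinal_syntax


section \<open>The semi-closed half-long line\<close>

text \<open>Throughout, the class \<^class>\<open>linorder_topology\<close> expresses that the topology of the type is the
  order topology.\<close>

typedef half_long_line = "(UNIV :: ctbl_ord set) \<times> {0..<1 :: real}"
  by (rule exI[of _ "(undefined, 0)"]) simp

setup_lifting type_definition_half_long_line

instantiation half_long_line :: linorder
begin

lift_definition less_eq_half_long_line :: "half_long_line \<Rightarrow> half_long_line \<Rightarrow> bool"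
  is "\<lambda>(a, s) (b, t). a < b \<or> a = b \<and> s \<le> t" .

lift_definition less_half_long_line :: "half_long_line \<Rightarrow> half_long_line \<Rightarrow> bool"
  is "\<lambda>(a, s) (b, t). a < b \<or> a = b \<and> s < t" .

instance
  by standard (transfer; auto)+

end

instantiation half_long_line :: linorder_topology
begin

definition open_half_long_line :: "half_long_line set \<Rightarrow> bool" where
  "open_half_long_line = generate_topology (range (\<lambda>a. {..<a}) \<union> range (\<lambda>a. {a<..}))"

instance
  by standard (rule open_half_long_line_def)

end

instantiation half_long_line :: zero
begin

lift_definition zero_half_long_line :: half_long_line
  is "(LEAST a. True, 0)" by simp

instance ..

end

lemma zero_le_half_long_line: "0 \<le> (x :: half_long_line)"
proof -
  obtain a s where x: "Rep_half_long_line x = (a, s)" "0 \<le> s"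
    using Rep_half_long_line[of x] by auto
  have "(LEAST a. True) \<le> a"
    by (rule Least_le) simp
  then show ?thesis
    using x by (auto simp: less_eq_half_long_line.rep_eq zero_half_long_line.rep_eq)
qed


section \<open>The long line\<close>

text \<open>
  A point \<open>Inl x\<close> is the point \<open>x\<close> of \<open>\<L>\<^sub>-\<close>, and \<open>Inr x\<close> is the point \<open>x\<close> of \<open>\<L>\<^sub>+\<close>.  The
  preorder \<open>pre_long_le\<close> reverses the order on \<open>\<L>\<^sub>-\<close> and puts \<open>\<L>\<^sub>-\<close> below \<open>\<L>\<^sub>+\<close>; the only distinct points
  that are below each other are \<open>Inl 0\<close> and \<open>Inr 0\<close>.
\<close>

fun pre_long_le :: "half_long_line + half_long_line \<Rightarrow> half_long_line + half_long_line \<Rightarrow> bool" where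
  "pre_long_le (Inl x) (Inl y) \<longleftrightarrow> y \<le> x"
| "pre_long_le (Inl x) (Inr y) \<longleftrightarrow> True"
| "pre_long_le (Inr x) (Inl y) \<longleftrightarrow> x = 0 \<and> y = 0"
| "pre_long_le (Inr x) (Inr y) \<longleftrightarrow> x \<le> y"

definition same_long_point ::
    "half_long_line + half_long_line \<Rightarrow> half_long_line + half_long_line \<Rightarrow> bool" where
  "same_long_point p q \<longleftrightarrow> p = q \<or> p = Inl 0 \<and> q = Inr 0 \<or> p = Inr 0 \<and> q = Inl 0"

lemma pre_long_le_trans: "pre_long_le p q \<Longrightarrow> pre_long_le q r \<Longrightarrow> pre_long_le p r"
  by (cases p; cases q; cases r) (auto simp: zero_le_half_long_line intro: order_antisym)

lemma same_long_point_iff: "same_long_point p q \<longleftrightarrow> pre_long_le p q \<and> pre_long_le q p"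
  by (cases p; cases q) (auto simp: same_long_point_def)

quotient_type long_line = "half_long_line + half_long_line" / same_long_point
proof (rule equivpI)
  show "reflp same_long_point" by (rule reflpI) (simp add: same_long_point_def)
  show "symp same_long_point" by (rule sympI) (auto simp: same_long_point_def)
  show "transp same_long_point" by (rule transpI) (auto simp: same_long_point_def)
qed

instantiation long_line :: linorder
begin

lift_definition less_eq_long_line :: "long_line \<Rightarrow> long_line \<Rightarrow> bool"
  is pre_long_le
  by (meson pre_long_le_trans same_long_point_iff)

definition less_long_line :: "long_line \<Rightarrow> long_line \<Rightarrow> bool" where
  "(p :: long_line) < q \<longleftrightarrow> p \<le> q \<and> \<not> q \<le> p"

instance
proof
  fix x y z :: long_line
  show "(x < y) = (x \<le> y \<and> \<not> y \<le> x)" by (rule less_long_line_def)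
  show "x \<le> x"
  proof transfer
    show "pre_long_le p p" for p by (cases p) auto
  qed
  show "x \<le> y \<Longrightarrow> y \<le> z \<Longrightarrow> x \<le> z"
    by transfer (rule pre_long_le_trans)
  show "x \<le> y \<Longrightarrow> y \<le> x \<Longrightarrow> x = y"
    by transfer (simp add: same_long_point_iff)
  show "x \<le> y \<or> y \<le> x"
  proof transfer
    show "pre_long_le p q \<or> pre_long_le q p" for p q by (cases p; cases q) auto
  qed
qed

end

instantiation long_line :: linorder_topology
begin

definition open_long_line :: "long_line set \<Rightarrow> bool" where
  "open_long_line = generate_topology (range (\<lambda>a. {..<a}) \<union> range (\<lambda>a. {a<..}))"

instance
  by standard (rule open_long_line_def)

end


section \<open>The extended lines\<close>

datatype ext_half_long_line = Half half_long_line | Half_Omega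

instantiation ext_half_long_line :: linorder
begin

fun less_eq_ext_half_long_line :: "ext_half_long_line \<Rightarrow> ext_half_long_line \<Rightarrow> bool" where
  "Half x \<le> Half y \<longleftrightarrow> x \<le> y"
| "u \<le> Half_Omega \<longleftrightarrow> True"
| "Half_Omega \<le> Half y \<longleftrightarrow> False"

definition less_ext_half_long_line :: "ext_half_long_line \<Rightarrow> ext_half_long_line \<Rightarrow> bool" where
  "(u :: ext_half_long_line) < v \<longleftrightarrow> u \<le> v \<and> \<not> v \<le> u"

instance
proof
  fix x y z :: ext_half_long_line
  show "(x < y) = (x \<le> y \<and> \<not> y \<le> x)" by (rule less_ext_half_long_line_def)
  show "x \<le> x" by (cases x) auto
  show "x \<le> y \<Longrightarrow> y \<le> z \<Longrightarrow> x \<le> z" by (cases x; cases y; cases z) auto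
  show "x \<le> y \<Longrightarrow> y \<le> x \<Longrightarrow> x = y" by (cases x; cases y) auto
  show "x \<le> y \<or> y \<le> x" by (cases x; cases y) auto
qed

end

instantiation ext_half_long_line :: linorder_topology
begin

definition open_ext_half_long_line :: "ext_half_long_line set \<Rightarrow> bool" where
  "open_ext_half_long_line = generate_topology (range (\<lambda>a. {..<a}) \<union> range (\<lambda>a. {a<..}))"

instance
  by standard (rule open_ext_half_long_line_def)

end

datatype ext_long_line = Minus_Omega | Long long_line | Plus_Omega

instantiation ext_long_line :: linorder
begin

fun less_eq_ext_long_line :: "ext_long_line \<Rightarrow> ext_long_line \<Rightarrow> bool" where
  "Minus_Omega \<le> v \<longleftrightarrow> True"
| "Long x \<le> Minus_Omega \<longleftrightarrow> False"
| "Long x \<le> Long y \<longleftrightarrow> x \<le> y"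
| "Long x \<le> Plus_Omega \<longleftrightarrow> True"
| "Plus_Omega \<le> v \<longleftrightarrow> v = Plus_Omega"

definition less_ext_long_line :: "ext_long_line \<Rightarrow> ext_long_line \<Rightarrow> bool" where
  "(u :: ext_long_line) < v \<longleftrightarrow> u \<le> v \<and> \<not> v \<le> u"

instance
proof
  fix x y z :: ext_long_line
  show "(x < y) = (x \<le> y \<and> \<not> y \<le> x)" by (rule less_ext_long_line_def)
  show "x \<le> x" by (cases x) auto
  show "x \<le> y \<Longrightarrow> y \<le> z \<Longrightarrow> x \<le> z" by (cases x; cases y; cases z) auto
  show "x \<le> y \<Longrightarrow> y \<le> x \<Longrightarrow> x = y" by (cases x; cases y) auto
  show "x \<le> y \<or> y \<le> x" by (cases x; cases y) auto
qed

end

instantiation ext_long_line :: linorder_topology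
begin

definition open_ext_long_line :: "ext_long_line set \<Rightarrow> bool" where
  "open_ext_long_line = generate_topology (range (\<lambda>a. {..<a}) \<union> range (\<lambda>a. {a<..}))"

instance
  by standard (rule open_ext_long_line_def)

end


section \<open>Powers\<close>

text \<open>The points of the \<open>n\<close>-th power are the extensional functions on \<open>{..<n}\<close>, whence the
  restriction in \<open>power_map\<close>.\<close>

definition power_space :: "nat \<Rightarrow> (nat \<Rightarrow> 'a::topological_space) topology" where
  "power_space n = product_topology (\<lambda>_. euclidean) {..<n}"

definition power_map :: "nat \<Rightarrow> ('a \<Rightarrow> 'b) \<Rightarrow> (nat \<Rightarrow> 'a) \<Rightarrow> (nat \<Rightarrow> 'b)" where
  "power_map n h x = (\<lambda>i\<in>{..<n}. h (x i))"


section \<open>Stone-Cech compactifications\<close>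

definition compactification :: "'a topology \<Rightarrow> 'b topology \<Rightarrow> ('a \<Rightarrow> 'b) \<Rightarrow> bool" where
  "compactification X K e \<longleftrightarrow>
     compact_space K \<and> Hausdorff_space K \<and> embedding_map X K e \<and>
     K closure_of (e ` topspace X) = topspace K"

text \<open>
  The universal property ranges over all compact Hausdorff spaces whose points lie in the
  type \<open>'c\<close>.  As HOL has no quantification over types inside formulas, \<open>'c\<close> is an explicit
  parameter; a theorem in which it is a free type variable states the property for every compact
  Hausdorff space.
\<close>

definition stone_cech_compactification ::
    "'c itself \<Rightarrow> 'a topology \<Rightarrow> 'b topology \<Rightarrow> ('a \<Rightarrow> 'b) \<Rightarrow> bool" where
  "stone_cech_compactification _ X K e \<longleftrightarrow>
     compactification X K e \<and>
     (\<forall>(Y :: 'c topology) f.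
        compact_space Y \<and> Hausdorff_space Y \<and> continuous_map X Y f \<longrightarrow>
        (\<exists>g. continuous_map K Y g \<and> (\<forall>x\<in>topspace X. g (e x) = f x) \<and>
           (\<forall>g'. continuous_map K Y g' \<and> (\<forall>x\<in>topspace X. g' (e x) = f x) \<longrightarrow>
              (\<forall>z\<in>topspace K. g' z = g z))))"

end

theory Submission
  imports Defs
begin

text \<open>
  At every point \<open>z\<close> of the extended power there is a rule choosing, from a stage \<open>k\<close> and
  a point \<open>p\<close> of the power, a neighbourhood of \<open>z\<close>, so that each sequence obeying the rule
  converges in the original power: at coordinates \<open>\<plusminus>\<Omega>\<close> the sequence is forced to be strictly monotone, hence
  converges as it cannot reach \<open>\<plusminus>\<Omega>\<close> in countably many steps, and at the other coordinates the neighbourhoods run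
  through a countable base.  If a map \<open>f\<close> into a compact Hausdorff space had no limit at \<open>z\<close>,
  then there would be disjoint closed sets both of which \<open>f\<close> visits arbitrarily near \<open>z\<close>;
  visiting them alternately along a sequence that obeys the rule contradicts continuity at
  the limit of the sequence.  So \<open>f\<close> has a limit at every \<open>z\<close>, which yields the extension.
\<close>

section \<open>From neighbourhood rules at points to the universal property\<close>

section \<open>Extending maps along convergence strategies\<close>

text \<open>A winning strategy in a topological game at \<open>z\<close>: one player names
  neighbourhoods of \<open>z\<close>, the opponent answers with points. The rule sees only the stage
  and the last point. The limit is demanded in \<open>X\<close> and need not be sent to
  \<open>z\<close>; it cannot be if \<open>z\<close> lies outside the image of
  \<open>e\<close>.\<close>

definition convergence_strategy ::
    "'a topology \<Rightarrow> 'b topology \<Rightarrow> ('a \<Rightarrow> 'b) \<Rightarrow> 'b \<Rightarrow> (nat \<Rightarrow> 'a \<Rightarrow> 'b set) \<Rightarrow> bool" where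
  "convergence_strategy X K e z N \<longleftrightarrow>
     (\<forall>k. \<forall>p\<in>topspace X. openin K (N k p) \<and> z \<in> N k p) \<and>
     (\<forall>x. (\<forall>k. x k \<in> topspace X \<and> e (x (Suc k)) \<in> N k (x k)) \<longrightarrow>
       (\<exists>l. limitin X x l sequentially))"

lemma no_alternating_sequence:
  assumes N: "convergence_strategy X K e z N" and f: "continuous_map X Y f"
    and C: "closedin Y C" and D: "closedin Y D" and disj: "C \<inter> D = {}"
    and visitC: "\<And>W. openin K W \<Longrightarrow> z \<in> W \<Longrightarrow> \<exists>x\<in>topspace X. e x \<in> W \<and> f x \<in> C"
    and visitD: "\<And>W. openin K W \<Longrightarrow> z \<in> W \<Longrightarrow> \<exists>x\<in>topspace X. e x \<in> W \<and> f x \<in> D"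
    and nonempty: "topspace X \<noteq> {}"
  shows False
proof -
  have nbhd: "openin K (N k p) \<and> z \<in> N k p" if "p \<in> topspace X" for k p
    using N that by (auto simp: convergence_strategy_def)
  \<comment> \<open>The starting point \<open>x 0\<close> is free. The parity test applies to
    \<open>k\<close> while the constraint concerns \<open>x (Suc k)\<close>, so odd indices are sent
    to \<open>C\<close> and even indices from 2 on to \<open>D\<close>.\<close>
  have "\<exists>x. \<forall>k. x k \<in> topspace X \<and>
      (e (x (Suc k)) \<in> N k (x k) \<and> f (x (Suc k)) \<in> (if even k then C else D))"
  proof (rule dependent_nat_choice)
    fix p k assume "p \<in> topspace X"
    then show "\<exists>q. q \<in> topspace X \<and> (e q \<in> N k p \<and> f q \<in> (if even k then C else D))"
      using visitC[of "N k p"] visitD[of "N k p"] nbhd[of p k] by auto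
  qed (use nonempty in blast)
  then obtain x where x: "\<And>k. x k \<in> topspace X" "\<And>k. e (x (Suc k)) \<in> N k (x k)"
    and alt: "\<And>k. f (x (Suc k)) \<in> (if even k then C else D)"
    by auto
  then obtain l where "limitin X x l sequentially"
    using N unfolding convergence_strategy_def by blast
  then have lim: "limitin Y (f \<circ> x) (f l) sequentially"
    by (rule continuous_map_limit[OF f])
  have "f l \<in> C"
  proof (rule limitin_closedin[OF limitin_subsequence[OF _ lim] C])
    show "strict_mono (\<lambda>k::nat. Suc (2 * k))" by (simp add: strict_mono_def)
    show "\<forall>\<^sub>F k in sequentially. ((f \<circ> x) \<circ> (\<lambda>k. Suc (2 * k))) k \<in> C"
      using alt[of "2 * _"] by simp
  qed simp
  moreover have "f l \<in> D"
  proof (rule limitin_closedin[OF limitin_subsequence[OF _ lim] D])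
    show "strict_mono (\<lambda>k::nat. Suc (Suc (2 * k)))" by (simp add: strict_mono_def)
    show "\<forall>\<^sub>F k in sequentially. ((f \<circ> x) \<circ> (\<lambda>k. Suc (Suc (2 * k)))) k \<in> D"
      using alt[of "Suc (2 * _)"] by simp
  qed simp
  ultimately show False using disj by blast
qed

text \<open>Otherwise each point of \<open>Y\<close> has an open neighbourhood that \<open>f\<close>
  eventually avoids. Finitely many of these cover \<open>Y\<close>, so eventually \<open>f\<close>
  would have no value in \<open>Y\<close> at all.\<close>

lemma compact_cluster_point:
  assumes "compact_space Y" and F: "F \<noteq> bot" "\<forall>\<^sub>F x in F. f x \<in> topspace Y"
  obtains y where "y \<in> topspace Y" "\<And>U. openin Y U \<Longrightarrow> y \<in> U \<Longrightarrow> \<exists>\<^sub>F x in F. f x \<in> U"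
proof (rule ccontr)
  assume "\<not> thesis"
  with that have "\<forall>y\<in>topspace Y. \<exists>U. openin Y U \<and> y \<in> U \<and> (\<forall>\<^sub>F x in F. f x \<notin> U)"
    unfolding not_frequently[symmetric] by blast
  then have "topspace Y \<subseteq> \<Union>{U. openin Y U \<and> (\<forall>\<^sub>F x in F. f x \<notin> U)}"
    by blast
  then obtain \<F> where \<F>: "finite \<F>" "\<F> \<subseteq> {U. openin Y U \<and> (\<forall>\<^sub>F x in F. f x \<notin> U)}"
      "topspace Y \<subseteq> \<Union>\<F>"
    using assms(1) unfolding compact_space_alt
    by (metis (no_types, lifting) mem_Collect_eq)
  have "\<forall>\<^sub>F x in F. \<forall>U\<in>\<F>. f x \<notin> U"
    using \<F> by (intro eventually_ball_finite) auto
  with F(2) have "\<forall>\<^sub>F x in F. False"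
    by eventually_elim (use \<F>(3) in blast)
  with F(1) show False by (simp add: trivial_limit_def)
qed

lemma frequently_atin_within:
  "frequently P (atin_within X a S) \<longleftrightarrow>
     a \<in> topspace X \<and> (\<forall>T. openin X T \<and> a \<in> T \<longrightarrow> (\<exists>x\<in>T. x \<in> S \<and> x \<noteq> a \<and> P x))"
  unfolding frequently_def eventually_atin_within by blast

text \<open>A compact Hausdorff space is regular, and a continuous map from a dense subspace into a
  regular space extends as soon as it has a limit at each remaining point. The map to be extended is
  \<open>f \<circ> d\<close>, where \<open>d\<close> inverts \<open>e\<close> on its image.\<close>

lemma convergence_strategy_imp_extension:
  assumes dense: "K closure_of (e ` topspace X) = topspace K"
    and emb: "embedding_map X K e"
    and strategy: "\<And>z. z \<in> topspace K \<Longrightarrow> \<exists>N. convergence_strategy X K e z N"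
    and Y: "compact_space Y" "Hausdorff_space Y"
    and f: "continuous_map X Y f"
  obtains g where "continuous_map K Y g" "\<And>x. x \<in> topspace X \<Longrightarrow> g (e x) = f x"
proof -
  let ?S = "e ` topspace X"
  obtain d where d: "homeomorphic_maps X (subtopology K ?S) e d"
    using emb by (auto simp: embedding_map_def homeomorphic_map_maps)
  then have cont_d: "continuous_map (subtopology K ?S) X d"
    and d_e: "\<And>x. x \<in> topspace X \<Longrightarrow> d (e x) = x"
    by (auto simp: homeomorphic_maps_def)
  have S: "?S \<subseteq> topspace K"
    using d by (auto simp: homeomorphic_maps_def continuous_map_in_subtopology
        continuous_map_def)
  have reg: "regular_space Y"
    using Y compact_Hausdorff_imp_regular_space by blast
  have maps: "f x \<in> topspace Y" if "x \<in> topspace X" for x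
    using continuous_map_image_subset_topspace[OF f] that by blast
  have lim: "\<exists>l. limitin Y (f \<circ> d) l (atin_within K z ?S)" if z: "z \<in> topspace K - ?S" for z
  proof (rule ccontr)
    let ?F = "atin_within K z ?S"
    assume no_limit: "\<nexists>l. limitin Y (f \<circ> d) l ?F"
    have visit: "\<exists>x\<in>topspace X. e x \<in> W \<and> f x \<in> B"
      if freq: "\<exists>\<^sub>F w in ?F. (f \<circ> d) w \<in> B" and W: "openin K W" "z \<in> W" for B W
    proof -
      obtain w where "w \<in> W" "w \<in> ?S" "(f \<circ> d) w \<in> B"
        using freq W unfolding frequently_atin_within by blast
      then show ?thesis using d_e by auto
    qed
    \<comment> \<open>Density of the image makes the filter at \<open>z\<close> proper, as a cluster
      point requires.\<close>
    have "\<exists>\<^sub>F w in ?F. True"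
      unfolding frequently_atin_within
    proof (intro conjI allI impI)
      have "z \<in> K closure_of ?S" using z dense by simp
      then show "\<exists>w\<in>T. w \<in> ?S \<and> w \<noteq> z \<and> True" if "openin K T \<and> z \<in> T" for T
        using that z unfolding in_closure_of by blast
    qed (use z in simp)
    then have nontriv: "?F \<noteq> bot" by (simp add: frequently_def trivial_limit_def)
    have ev: "\<forall>\<^sub>F w in ?F. (f \<circ> d) w \<in> topspace Y"
      unfolding eventually_atin_within using z maps d_e by (auto intro!: exI[of _ "topspace K"])
    obtain y where y: "y \<in> topspace Y"
      "\<And>U. openin Y U \<Longrightarrow> y \<in> U \<Longrightarrow> \<exists>\<^sub>F w in ?F. (f \<circ> d) w \<in> U"
      using compact_cluster_point[OF Y(1) nontriv ev] by blast
    \<comment> \<open>The cluster point \<open>y\<close> is not a limit, so the values keep leaving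
      some open \<open>U\<close> around \<open>y\<close>. By regularity \<open>U\<close> contains a
      closed neighbourhood \<open>C\<close> of \<open>y\<close>, and the values keep returning to
      it. The two disjoint closed sets are \<open>C\<close> and the complement of
      \<open>U\<close>.\<close>
    have "\<not> limitin Y (f \<circ> d) y ?F" using no_limit by blast
    then obtain U where U: "openin Y U" "y \<in> U" "\<exists>\<^sub>F w in ?F. (f \<circ> d) w \<notin> U"
      using y(1) by (auto simp: limitin_def frequently_def)
    obtain V C where V: "openin Y V" "y \<in> V" "V \<subseteq> C" and C: "closedin Y C" "C \<subseteq> U"
      using reg[folded neighbourhood_base_of_closedin, unfolded neighbourhood_base_of,
          rule_format, OF conjI[OF U(1,2)]]
      by blast
    have freqC: "\<exists>\<^sub>F w in ?F. (f \<circ> d) w \<in> C"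
      using y(2)[OF V(1,2)] V(3) by (auto elim: frequently_elim1)
    have freqD: "\<exists>\<^sub>F w in ?F. (f \<circ> d) w \<in> topspace Y - U"
      using frequently_eventually_conj[OF U(3) ev] by (auto elim: frequently_elim1)
    obtain N where N: "convergence_strategy X K e z N" using strategy z by blast
    have "closedin Y (topspace Y - U)" using U(1) by blast
    moreover have "C \<inter> (topspace Y - U) = {}" using C(2) by blast
    moreover have "topspace X \<noteq> {}" using visit[OF freqC, of "topspace K"] z by auto
    ultimately show False
      using no_alternating_sequence[OF N f C(1)] visit[OF freqC] visit[OF freqD] by blast
  qed
  obtain g where g: "continuous_map (subtopology K (topspace K)) Y g"
      "\<And>w. w \<in> ?S \<Longrightarrow> g w = (f \<circ> d) w"
    using continuous_map_extension_pointwise_alt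
      [OF reg S _ continuous_map_compose[OF cont_d f] lim] dense by auto
  show thesis
  proof
    show "continuous_map K Y g" using g(1) by simp
    show "g (e x) = f x" if "x \<in> topspace X" for x using g(2) d_e that by simp
  qed
qed

text \<open>The strategies give existence of the extension. Uniqueness comes from density:
  continuous maps into a Hausdorff space that agree on a set agree on its closure.\<close>

lemma stone_cech_compactificationI:
  assumes "compactification X K e"
    and "\<And>z. z \<in> topspace K \<Longrightarrow> \<exists>N. convergence_strategy X K e z N"
  shows "stone_cech_compactification TYPE('c) X K e"
proof -
  have comp: "K closure_of (e ` topspace X) = topspace K" "embedding_map X K e"
    using assms(1) by (auto simp: compactification_def)
  show ?thesis
    unfolding stone_cech_compactification_def
  proof (intro conjI allI impI assms(1), elim conjE)
    fix Y :: "'c topology" and f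
    assume Y: "compact_space Y" "Hausdorff_space Y" and f: "continuous_map X Y f"
    obtain g where g: "continuous_map K Y g" "\<And>x. x \<in> topspace X \<Longrightarrow> g (e x) = f x"
      using convergence_strategy_imp_extension[OF comp assms(2) Y f] by blast
    have "g' z = g z"
      if "continuous_map K Y g'" "\<forall>x\<in>topspace X. g' (e x) = f x" "z \<in> topspace K" for g' z
    proof (rule forall_in_closure_of_eq[OF _ Y(2) that(1) g(1)])
      show "z \<in> K closure_of (e ` topspace X)" using comp(1) that(3) by simp
      show "g' w = g w" if "w \<in> e ` topspace X" for w
        using that g(2) \<open>\<forall>x\<in>topspace X. g' (e x) = f x\<close> by auto
    qed
    with g show "\<exists>g. continuous_map K Y g \<and> (\<forall>x\<in>topspace X. g (e x) = f x) \<and>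
        (\<forall>g'. continuous_map K Y g' \<and> (\<forall>x\<in>topspace X. g' (e x) = f x) \<longrightarrow>
          (\<forall>z\<in>topspace K. g' z = g z))"
      by blast
  qed
qed

section \<open>Embeddings and strategies in finite powers\<close>

section \<open>Powers\<close>

lemma topspace_power_space [simp]: "topspace (power_space n) = (\<Pi>\<^sub>E i\<in>{..<n}. UNIV)"
  by (simp add: power_space_def)

text \<open>Used for open boxes, to see that \<open>power_map\<close> is open, and for the full box,
  to compute the closure of the image.\<close>

lemma power_map_image_PiE:
  "power_map n h ` (\<Pi>\<^sub>E i\<in>{..<n}. S i) = (\<Pi>\<^sub>E i\<in>{..<n}. h ` S i)"
proof (intro equalityI subsetI)
  fix y assume y: "y \<in> (\<Pi>\<^sub>E i\<in>{..<n}. h ` S i)"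
  then have "\<forall>i\<in>{..<n}. \<exists>x. x \<in> S i \<and> h x = y i" by (fastforce simp: PiE_iff)
  then obtain x where x: "\<And>i. i < n \<Longrightarrow> x i \<in> S i \<and> h (x i) = y i" by (metis lessThan_iff)
  then have "y = power_map n h (restrict x {..<n})"
    using y by (auto simp: power_map_def PiE_iff extensional_def)
  moreover have "restrict x {..<n} \<in> (\<Pi>\<^sub>E i\<in>{..<n}. S i)" using x by auto
  ultimately show "y \<in> power_map n h ` (\<Pi>\<^sub>E i\<in>{..<n}. S i)" by blast
qed (auto simp: power_map_def)

text \<open>Openness is checked on boxes: the image of a box is the box of the images, which is open
  because there are only finitely many factors.\<close>

lemma embedding_map_power_map:
  fixes h :: "'a::topological_space \<Rightarrow> 'b::topological_space"
  assumes cont: "continuous_on UNIV h" and opn: "\<And>U. open U \<Longrightarrow> open (h ` U)" and inj: "inj h"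
  shows "embedding_map (power_space n) (power_space n) (power_map n h)"
proof (rule injective_open_imp_embedding_map)
  have "continuous_map (euclidean :: 'a topology) (euclidean :: 'b topology) h"
    using cont by simp
  then have "continuous_map (power_space n) euclidean (h \<circ> (\<lambda>x. x i))" if "i \<in> {..<n}" for i
    unfolding power_space_def using continuous_map_product_projection[OF that]
    by (rule continuous_map_compose[rotated])
  then show "continuous_map (power_space n) (power_space n) (power_map n h)"
    unfolding power_space_def[where 'a = 'b] continuous_map_componentwise
    by (auto simp: power_map_def o_def)
  show "inj_on (power_map n h) (topspace (power_space n))"
  proof (rule inj_onI)
    fix x y assume xy: "x \<in> topspace (power_space n)" "y \<in> topspace (power_space n)"
      and eq: "power_map n h x = power_map n h y"
    show "x = y"
    proof (rule PiE_ext)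
      show "x \<in> (\<Pi>\<^sub>E i\<in>{..<n}. UNIV)" "y \<in> (\<Pi>\<^sub>E i\<in>{..<n}. UNIV)" using xy by simp_all
      show "x i = y i" if "i \<in> {..<n}" for i
        using fun_cong[OF eq, of i] that by (simp add: power_map_def inj_eq[OF inj])
    qed
  qed
  show "open_map (power_space n) (power_space n) (power_map n h)"
    unfolding open_map_def
  proof (intro allI impI)
    fix U :: "(nat \<Rightarrow> 'a) set" assume U: "openin (power_space n) U"
    show "openin (power_space n) (power_map n h ` U)"
    proof (subst openin_subopen, intro ballI)
      fix y assume "y \<in> power_map n h ` U"
      then obtain x where x: "x \<in> U" "y = power_map n h x" by blast
      obtain V where "\<forall>i\<in>{..<n}. openin euclidean (V i)"
          and V: "x \<in> Pi\<^sub>E {..<n} V" "Pi\<^sub>E {..<n} V \<subseteq> U"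
        using U[unfolded power_space_def openin_product_topology_alt, rule_format, OF x(1)] by blast
      then have V_open: "\<And>i. i < n \<Longrightarrow> open (V i)" by simp
      have "openin (power_space n) (power_map n h ` Pi\<^sub>E {..<n} V)"
        unfolding power_map_image_PiE power_space_def
        using V_open opn by (subst openin_PiE_gen) auto
      then show "\<exists>T. openin (power_space n) T \<and> y \<in> T \<and> T \<subseteq> power_map n h ` U"
        using V x(2) by blast
    qed
  qed
qed

text \<open>The coordinate strategies are played simultaneously. The \<open>i\<close>-th factor of
  the box looks only at the \<open>i\<close>-th coordinate of the previous point, so each coordinate
  sequence obeys its own rule and converges; convergence in the product is coordinatewise.\<close>

lemma convergence_strategy_power:
  assumes "\<And>b. \<exists>N. convergence_strategy euclidean euclidean h b N"
    and z: "z \<in> topspace (power_space n)"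
  shows "\<exists>N. convergence_strategy (power_space n) (power_space n) (power_map n h) z N"
proof -
  obtain M where M: "\<And>b. convergence_strategy euclidean euclidean h b (M b)"
    using assms(1) by metis
  then have nbhd: "\<And>b k p. open (M b k p) \<and> b \<in> M b k p"
    by (simp add: convergence_strategy_def)
  define N where "N = (\<lambda>k p. \<Pi>\<^sub>E i\<in>{..<n}. M (z i) k (p i))"
  have "openin (power_space n) (N k p) \<and> z \<in> N k p" for k p
    unfolding N_def power_space_def using z nbhd by (subst openin_PiE_gen) (auto simp: PiE_iff)
  moreover have "\<exists>l. limitin (power_space n) x l sequentially"
    if x: "\<forall>k. x k \<in> topspace (power_space n) \<and> power_map n h (x (Suc k)) \<in> N k (x k)" for x
  proof -
    have "\<exists>l. (\<lambda>k. x k i) \<longlonglongrightarrow> l" if i: "i < n" for i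
    proof -
      have "h (x (Suc k) i) \<in> M (z i) k (x k i)" for k
        using x i by (auto simp: N_def PiE_iff power_map_def dest!: spec[of _ k])
      then show ?thesis
        using M[of "z i"] by (auto simp: convergence_strategy_def)
    qed
    then obtain l where "\<And>i. i < n \<Longrightarrow> (\<lambda>k. x k i) \<longlonglongrightarrow> l i" by metis
    then have "limitin (power_space n) x (restrict l {..<n}) sequentially"
      using x unfolding power_space_def limitin_componentwise by auto
    then show ?thesis by blast
  qed
  ultimately show ?thesis
    unfolding convergence_strategy_def by blast
qed

section \<open>Linear orders: compactness, countable neighbourhood bases, infima from
  suprema\<close>

section \<open>Completions of linear orders\<close>

text \<open>The Heine-Borel argument: let \<open>S\<close> consist of the points whose initial
  segment is finitely covered. Its supremum \<open>s\<close> belongs to \<open>S\<close>, and a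
  point above \<open>s\<close> would allow the covered segment to be prolonged past
  \<open>s\<close>.\<close>

lemma compact_UNIV_complete_linorder:
  assumes complete: "\<And>A :: 'b::linorder_topology set. \<exists>s. \<forall>b. s \<le> b \<longleftrightarrow> (\<forall>a\<in>A. a \<le> b)"
  shows "compact (UNIV :: 'b set)"
  unfolding compact_eq_Heine_Borel
proof (intro allI impI, elim conjE)
  fix \<C> :: "'b set set" assume opn: "\<forall>U\<in>\<C>. open U" and cover: "UNIV \<subseteq> \<Union>\<C>"
  define S where "S = {x. \<exists>\<D>\<subseteq>\<C>. finite \<D> \<and> {..x} \<subseteq> \<Union>\<D>}"
  have extend: "y \<in> S" if "x \<in> S" "U \<in> \<C>" "{..y} \<subseteq> {..x} \<union> U" for x y U
  proof -
    obtain \<D> where "\<D> \<subseteq> \<C>" "finite \<D>" "{..x} \<subseteq> \<Union>\<D>" using \<open>x \<in> S\<close> by (auto simp: S_def)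
    then show ?thesis
      unfolding S_def using that by (intro CollectI exI[of _ "insert U \<D>"]) auto
  qed
  obtain s where s: "\<And>b. s \<le> b \<longleftrightarrow> (\<forall>a\<in>S. a \<le> b)" using complete by blast
  obtain U where U: "U \<in> \<C>" "s \<in> U" "open U" using cover opn by blast
  have "s \<in> S"
  proof (cases "\<exists>y. y < s")
    case True
    then obtain b where b: "b < s" "{b<..s} \<subseteq> U" using open_left[OF U(3,2)] by blast
    then obtain x where "x \<in> S" "b < x" using s by (meson not_le)
    have "{..s} \<subseteq> {..x} \<union> U"
    proof
      fix y assume "y \<in> {..s}"
      then show "y \<in> {..x} \<union> U" using \<open>b < x\<close> b(2) by (cases "y \<le> b") (auto simp: subset_iff)
    qed
    then show ?thesis by (rule extend[OF \<open>x \<in> S\<close> U(1)])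
  \<comment> \<open>Here \<open>s\<close> is the least element, so its initial segment is a single
    point and \<open>U\<close> alone covers it.\<close>
  next
    case False
    then have "{..s} \<subseteq> U" using U(2) by (auto simp: le_less)
    then show ?thesis unfolding S_def using U(1) by (intro CollectI exI[of _ "{U}"]) auto
  qed
  have "\<not> s < y" for y
  proof
    assume "s < y"
    then obtain b where b: "s < b" "{s..<b} \<subseteq> U" using open_right[OF U(3,2)] by blast
    \<comment> \<open>\<open>U\<close> is known to cover only the points from \<open>s\<close> up
      to, but excluding, \<open>b\<close>; \<open>U'\<close> takes care of \<open>b\<close>
      itself.\<close>
    obtain U' where U': "U' \<in> \<C>" "b \<in> U'" using cover by blast
    obtain \<D> where \<D>: "\<D> \<subseteq> \<C>" "finite \<D>" "{..s} \<subseteq> \<Union>\<D>" using \<open>s \<in> S\<close> by (auto simp: S_def)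
    have "x \<in> \<Union>(insert U (insert U' \<D>))" if "x \<le> b" for x
      using that b(2) U'(2) \<D>(3) by (cases "x \<le> s"; cases "x = b") (auto simp: subset_iff not_le order_le_less)
    then have "b \<in> S"
      unfolding S_def using U(1) U'(1) \<D>(1,2)
      by (intro CollectI exI[of _ "insert U (insert U' \<D>)"]) auto
    with s[of s] b(1) show False by auto
  qed
  then have "{..s} = UNIV" by (auto simp: not_less)
  with \<open>s \<in> S\<close> show "\<exists>\<D>\<subseteq>\<C>. finite \<D> \<and> UNIV \<subseteq> \<Union>\<D>" by (auto simp: S_def)
qed

text \<open>The rays that contain \<open>z\<close> and end at a point of \<open>D\<close> are
  countably many and shrink to \<open>z\<close>. Intersecting the first of them gives decreasing
  sets \<open>V k\<close>, so a sequence with \<open>x k\<close> in \<open>V k\<close> ends up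
  inside every such ray.\<close>

lemma countable_order_separating_imp_tendsto:
  fixes z :: "'a::linorder_topology"
  assumes D: "countable D" and below: "\<And>x. x < z \<Longrightarrow> \<exists>d\<in>D. x \<le> d \<and> d < z"
    and above: "\<And>x. z < x \<Longrightarrow> \<exists>d\<in>D. z < d \<and> d \<le> x"
  obtains V :: "nat \<Rightarrow> 'a set" where "\<And>k. open (V k)" "\<And>k. z \<in> V k"
    "\<And>x. (\<And>k. x k \<in> V k) \<Longrightarrow> x \<longlonglongrightarrow> z"
proof -
  define I where "I = (\<lambda>d. if d < z then {d<..} else if z < d then {..<d} else UNIV)"
  \<comment> \<open>The set \<open>insert z D\<close> is nonempty, so its enumeration stays inside
    it; \<open>z\<close> itself contributes \<open>UNIV\<close>.\<close>
  define V where "V = (\<lambda>k. \<Inter>j\<le>k. I (from_nat_into (insert z D) j))"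
  have V: "V k \<subseteq> I d" if "d \<in> D" "to_nat_on (insert z D) d \<le> k" for d k
    using that D by (force simp: V_def)
  show thesis
  proof
    show "open (V k)" for k unfolding V_def I_def by (intro open_INT) auto
    show "z \<in> V k" for k by (auto simp: V_def I_def)
    fix x assume x: "\<And>k. x k \<in> V k"
    show "x \<longlonglongrightarrow> z"
    proof (rule order_tendstoI)
      fix a assume "a < z"
      then obtain d where d: "d \<in> D" "a \<le> d" "d < z" using below by blast
      then have "a < x k" if "k \<ge> to_nat_on (insert z D) d" for k
        using V[OF d(1) that] x[of k] d(2,3) by (auto simp: I_def split: if_splits)
      then show "\<forall>\<^sub>F k in sequentially. a < x k" by (auto simp: eventually_sequentially)
    next
      fix a assume "z < a"
      then obtain d where d: "d \<in> D" "d \<le> a" "z < d" using above by blast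
      then have "x k < a" if "k \<ge> to_nat_on (insert z D) d" for k
        using V[OF d(1) that] x[of k] d(2,3) by (auto simp: I_def split: if_splits)
      then show "\<forall>\<^sub>F k in sequentially. x k < a" by (auto simp: eventually_sequentially)
    qed
  qed
qed

lemma Sup_existsI:
  fixes s :: "'a::order"
  assumes upper: "\<And>a. a \<in> A \<Longrightarrow> a \<le> s" and least: "\<And>b. \<forall>a\<in>A. a \<le> b \<Longrightarrow> s \<le> b"
  shows "\<exists>s. \<forall>b. s \<le> b \<longleftrightarrow> (\<forall>a\<in>A. a \<le> b)"
proof (intro exI[of _ s] allI iffI ballI)
  show "a \<le> b" if "s \<le> b" "a \<in> A" for a b
    using upper[OF that(2)] that(1) by (rule order_trans)
qed (rule least)

text \<open>Turns existence of suprema into existence of infima, both for complete orders and for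
  the half-long line, where only bounded sets have suprema.\<close>

lemma Sup_lower_bounds_is_Inf:
  fixes s :: "'a::order"
  assumes s: "\<And>b. s \<le> b \<longleftrightarrow> (\<forall>a\<in>{c. \<forall>a\<in>A. c \<le> a}. a \<le> b)"
  shows "b \<le> s \<longleftrightarrow> (\<forall>a\<in>A. b \<le> a)"
proof
  assume "b \<le> s"
  moreover have "s \<le> a" if "a \<in> A" for a unfolding s using that by blast
  ultimately show "\<forall>a\<in>A. b \<le> a" using order_trans by blast
next
  assume "\<forall>a\<in>A. b \<le> a"
  with s[THEN iffD1, OF order_refl] show "b \<le> s" by blast
qed

section \<open>Completions of a linear order by endpoints\<close>

text \<open>Abstracts what \<open>Half\<close> and \<open>Long\<close> share: the larger order is
  complete and adds only endpoints, which are limits of image points. \<open>separating\<close>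
  provides countable neighbourhood bases in the smaller order; the last two conditions say that no
  countable set of its points reaches an added endpoint.\<close>

locale order_completion =
  fixes h :: "'a::linorder_topology \<Rightarrow> 'b::linorder_topology"
  assumes less_iff: "\<And>x y. h x < h y \<longleftrightarrow> x < y"
    and endpoint: "\<And>b. b \<notin> range h \<Longrightarrow> (\<forall>x. h x < b) \<or> (\<forall>x. b < h x)"
    and dense: "\<And>b c. b < c \<Longrightarrow> \<exists>x. b < h x \<and> h x < c"
    and complete: "\<And>A :: 'b set. \<exists>s. \<forall>b. s \<le> b \<longleftrightarrow> (\<forall>a\<in>A. a \<le> b)"
    and separating: "\<And>z :: 'a. \<exists>D. countable D \<and>
      (\<forall>x<z. \<exists>d\<in>D. x \<le> d \<and> d < z) \<and> (\<forall>x>z. \<exists>d\<in>D. z < d \<and> d \<le> x)"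
    and bounded_above: "\<And>b (C :: 'a set). countable C \<Longrightarrow> \<forall>x. h x < b \<Longrightarrow> \<exists>y. \<forall>x\<in>C. x \<le> y"
    and bounded_below: "\<And>b (C :: 'a set). countable C \<Longrightarrow> \<forall>x. b < h x \<Longrightarrow> \<exists>y. \<forall>x\<in>C. y \<le> x"
begin

lemma le_iff: "h x \<le> h y \<longleftrightarrow> x \<le> y"
  using less_iff[of y x] by (simp only: linorder_not_less[symmetric])

lemma complete_Inf: "\<exists>s. \<forall>b. b \<le> s \<longleftrightarrow> (\<forall>a\<in>A. b \<le> (a :: 'b))"
proof -
  obtain s where s: "\<And>b. s \<le> b \<longleftrightarrow> (\<forall>a\<in>{c. \<forall>a\<in>A. c \<le> a}. a \<le> b)"
    using complete[of "{c. \<forall>a\<in>A. c \<le> a}"] by metis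
  show ?thesis using Sup_lower_bounds_is_Inf[OF s] by blast
qed

lemma inj: "inj h"
  by (intro injI order_antisym) (simp_all flip: le_iff)

text \<open>Two distinct points above the whole image would have an image point between them, and
  likewise below. So the complement has at most two points and is closed.\<close>

lemma open_range: "open (range h)"
proof -
  have unique: "b = c" if "(\<forall>x. h x < b) \<and> (\<forall>x. h x < c) \<or> (\<forall>x. b < h x) \<and> (\<forall>x. c < h x)" for b c
    using that dense[of b c] dense[of c b] by (metis less_asym linorder_cases)
  then have "\<exists>c. {b. \<forall>x. h x < b} \<subseteq> {c}" "\<exists>c. {b. \<forall>x. b < h x} \<subseteq> {c}" by blast+
  then have "finite {b. \<forall>x. h x < b}" "finite {b. \<forall>x. b < h x}"
    by (meson finite.simps finite_subset)+
  then have "finite ({b. \<forall>x. h x < b} \<union> {b. \<forall>x. b < h x})" by blast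
  then have "finite (- range h)"
    by (rule rev_finite_subset) (use endpoint in blast)
  then show ?thesis using finite_imp_closed open_closed by blast
qed

lemma vimage_lessThan: "open (h -` {..<b})"
proof (cases "b \<in> range h")
  case True
  then obtain a where "b = h a" by blast
  then have "h -` {..<b} = {..<a}" by (auto simp: less_iff)
  then show ?thesis by simp
next
  case False
  then have "h -` {..<b} = UNIV \<or> h -` {..<b} = {}"
    using endpoint[of b] by (auto dest: less_asym)
  then show ?thesis by auto
qed

lemma vimage_greaterThan: "open (h -` {b<..})"
proof (cases "b \<in> range h")
  case True
  then obtain a where "b = h a" by blast
  then have "h -` {b<..} = {a<..}" by (auto simp: less_iff)
  then show ?thesis by simp
next
  case False
  then have "h -` {b<..} = UNIV \<or> h -` {b<..} = {}"
    using endpoint[of b] by (auto dest: less_asym)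
  then show ?thesis by auto
qed

lemma continuous: "continuous_on UNIV h"
proof -
  have "open (h -` B)" if "open B" for B
    using that[unfolded open_generated_order]
  proof induction
    case (UN K)
    then show ?case by (simp add: vimage_Union open_UN)
  qed (auto simp: vimage_lessThan vimage_greaterThan)
  then show ?thesis by (simp add: continuous_on_open_vimage)
qed

lemma open_image: "open (h ` U)" if "open U"
  using that[unfolded open_generated_order]
proof induction
  case UNIV
  then show ?case by (rule open_range)
next
  case (Int A B)
  then show ?case by (simp add: image_Int[OF inj] open_Int)
next
  case (UN K)
  then show ?case by (simp add: image_Union open_UN)
next
  case (Basis S)
  have "h ` {..<a} = range h \<inter> {..<h a}" "h ` {a<..} = range h \<inter> {h a<..}" for a
    using less_iff by auto
  with Basis show ?case by (auto simp: open_range open_Int)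
qed

lemma closure_range: "closure (range h) = UNIV"
proof -
  have "b \<in> closure (range h)" for b
  proof (cases "b \<in> range h")
    case True
    then show ?thesis using closure_subset[of "range h"] by (rule rev_subsetD)
  next
    case False
    show ?thesis
      unfolding closure_iff_nhds_not_empty
    proof (intro allI impI)
      fix A V assume V: "V \<subseteq> A" "open V" "b \<in> V"
      from endpoint[OF False] show "range h \<inter> A \<noteq> {}"
      proof
        assume "\<forall>x. h x < b"
        \<comment> \<open>\<open>open_left\<close> asks for some point below \<open>b\<close>; every
          image point is one, and \<open>h undefined\<close> is an arbitrary choice.\<close>
        then obtain c where c: "c < b" "{c<..b} \<subseteq> V"
          using open_left[OF V(2,3), of "h undefined"] by auto
        obtain x where "c < h x" "h x < b" using dense[OF c(1)] by blast
        then have "h x \<in> V" using c(2) by (simp add: subset_iff)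
        then have "h x \<in> A" using V(1) by blast
        then show ?thesis by blast
      next
        assume "\<forall>x. b < h x"
        then obtain c where c: "b < c" "{b..<c} \<subseteq> V"
          using open_right[OF V(2,3), of "h undefined"] by auto
        obtain x where "b < h x" "h x < c" using dense[OF c(1)] by blast
        then have "h x \<in> V" using c(2) by (simp add: subset_iff)
        then have "h x \<in> A" using V(1) by blast
        then show ?thesis by blast
      qed
    qed
  qed
  then show ?thesis by (simp add: set_eq_iff)
qed

text \<open>The values have a supremum \<open>s\<close> in the larger order. Being countable, the
  sequence is bounded by some \<open>y\<close>, so \<open>s\<close> lies between
  \<open>h (x 0)\<close> and \<open>h y\<close> and cannot be an added endpoint. Hence
  \<open>s = h l\<close>, and \<open>l\<close> is the limit.\<close>

lemma increasing_convergent: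
  assumes b: "\<forall>x. h x < b" and inc: "incseq (x :: nat \<Rightarrow> 'a)"
  shows "\<exists>l. x \<longlonglongrightarrow> l"
proof -
  obtain s where s: "\<And>c. s \<le> c \<longleftrightarrow> (\<forall>k. h (x k) \<le> c)"
    using complete[of "range (\<lambda>k. h (x k))"] by auto
  obtain y where "\<forall>k. x k \<le> y"
    using bounded_above[OF _ b, of "range x"] by auto
  then have "s \<le> h y" by (simp add: s le_iff)
  moreover have "h (x 0) \<le> s" using s[of s] by simp
  ultimately have "s \<in> range h" using endpoint[of s] by (metis not_le)
  then obtain l where l: "s = h l" by blast
  have le: "l \<le> w \<longleftrightarrow> (\<forall>k. x k \<le> w)" for w
    using s[of "h w"] by (simp add: l le_iff)
  have "x \<longlonglongrightarrow> l"
  proof (rule increasing_tendsto)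
    show "\<forall>\<^sub>F k in sequentially. x k \<le> l" using le[of l] by simp
    fix w assume "w < l"
    then have "\<not> (\<forall>k. x k \<le> w)" unfolding le[symmetric] by simp
    then obtain k where "w < x k" by (auto simp: not_le)
    then have "w < x j" if "j \<ge> k" for j using incseqD[OF inc that] by simp
    then show "\<forall>\<^sub>F k in sequentially. w < x k" by (auto simp: eventually_sequentially)
  qed
  then show ?thesis by blast
qed

lemma decreasing_convergent:
  assumes b: "\<forall>x. b < h x" and dec: "decseq (x :: nat \<Rightarrow> 'a)"
  shows "\<exists>l. x \<longlonglongrightarrow> l"
proof -
  obtain s where s: "\<And>c. c \<le> s \<longleftrightarrow> (\<forall>k. c \<le> h (x k))"
    using complete_Inf[of "range (\<lambda>k. h (x k))"] by auto
  obtain y where "\<forall>k. y \<le> x k"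
    using bounded_below[OF _ b, of "range x"] by auto
  then have "h y \<le> s" by (simp add: s le_iff)
  moreover have "s \<le> h (x 0)" using s[of s] by simp
  ultimately have "s \<in> range h" using endpoint[of s] by (metis not_le)
  then obtain l where l: "s = h l" by blast
  have le: "w \<le> l \<longleftrightarrow> (\<forall>k. w \<le> x k)" for w
    using s[of "h w"] by (simp add: l le_iff)
  have "x \<longlonglongrightarrow> l"
  proof (rule decreasing_tendsto)
    show "\<forall>\<^sub>F k in sequentially. l \<le> x k" using le[of l] by simp
    fix w assume "l < w"
    then have "\<not> (\<forall>k. w \<le> x k)" unfolding le[symmetric] by simp
    then obtain k where "x k < w" by (auto simp: not_le)
    then have "x j < w" if "j \<ge> k" for j using decseqD[OF dec that] by simp
    then show "\<forall>\<^sub>F k in sequentially. x k < w" by (auto simp: eventually_sequentially)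
  qed
  then show ?thesis by blast
qed

text \<open>At an image point the rule depends on the stage alone and runs through a countable
  neighbourhood base. At an added endpoint it depends on the last point alone and forces strict
  monotonicity.\<close>

lemma convergence_strategy_point: "\<exists>N. convergence_strategy euclidean euclidean h b N"
proof (cases "b \<in> range h")
  case True
  then obtain a where a: "b = h a" by blast
  obtain D where D: "countable D" "\<forall>x<a. \<exists>d\<in>D. x \<le> d \<and> d < a" "\<forall>x>a. \<exists>d\<in>D. a < d \<and> d \<le> x"
    using separating[of a] by blast
  obtain V :: "nat \<Rightarrow> 'a set" where V: "\<And>k. open (V k)" "\<And>k. a \<in> V k"
      "\<And>x. (\<And>k. x k \<in> V k) \<Longrightarrow> x \<longlonglongrightarrow> a"
  proof (rule countable_order_separating_imp_tendsto[OF D(1) D(2,3)[rule_format]])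
    fix V :: "nat \<Rightarrow> 'a set"
    assume "\<And>k. open (V k)" "\<And>k. a \<in> V k" "\<And>x. (\<And>k. x k \<in> V k) \<Longrightarrow> x \<longlonglongrightarrow> a"
    then show thesis by (rule that)
  qed
  have "x \<longlonglongrightarrow> a" if "\<And>k. h (x (Suc k)) \<in> h ` V k" for x
  proof -
    have "x (Suc k) \<in> V k" for k using that[of k] by (simp add: inj_image_mem_iff[OF inj])
    \<comment> \<open>The rule leaves \<open>x 0\<close> unconstrained, so convergence is obtained
      first for the shifted sequence.\<close>
    then have "(\<lambda>k. x (Suc k)) \<longlonglongrightarrow> a" by (rule V(3))
    then show ?thesis by (rule filterlim_sequentially_Suc[THEN iffD1])
  qed
  then have "convergence_strategy euclidean euclidean h b (\<lambda>k p. h ` V k)"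
    unfolding convergence_strategy_def using V(1,2) by (auto simp: a open_image)
  then show ?thesis by blast
next
  case False
  from endpoint[OF False] show ?thesis
  proof
    assume b: "\<forall>x. h x < b"
    have "\<exists>l. x \<longlonglongrightarrow> l" if "\<And>k. h (x k) < h (x (Suc k))" for x
      using that by (intro increasing_convergent[OF b] incseq_SucI) (simp add: less_iff less_imp_le)
    then have "convergence_strategy euclidean euclidean h b (\<lambda>k p. {h p<..})"
      using b by (auto simp: convergence_strategy_def)
    then show ?thesis by blast
  next
    assume b: "\<forall>x. b < h x"
    have "\<exists>l. x \<longlonglongrightarrow> l" if "\<And>k. h (x (Suc k)) < h (x k)" for x
      using that by (intro decreasing_convergent[OF b] decseq_SucI) (simp add: less_iff less_imp_le)
    then have "convergence_strategy euclidean euclidean h b (\<lambda>k p. {..<h p})"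
      using b by (auto simp: convergence_strategy_def)
    then show ?thesis by blast
  qed
qed

lemma compactification_power:
  "compactification (power_space n :: (nat \<Rightarrow> 'a) topology)
     (power_space n :: (nat \<Rightarrow> 'b) topology) (power_map n h)"
  unfolding compactification_def
proof (intro conjI)
  have "compact_space (euclidean :: 'b topology)"
    using compact_UNIV_complete_linorder[OF complete] by (simp add: compact_space_def)
  then show "compact_space (power_space n :: (nat \<Rightarrow> 'b) topology)"
    by (simp add: power_space_def compact_space_product_topology)
  have "Hausdorff_space (euclidean :: 'b topology)"
    unfolding Hausdorff_space_def disjnt_def using hausdorff by auto
  then show "Hausdorff_space (power_space n :: (nat \<Rightarrow> 'b) topology)"
    by (simp add: power_space_def Hausdorff_space_product_topology)
  show "embedding_map (power_space n) (power_space n) (power_map n h)"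
    by (rule embedding_map_power_map[OF continuous open_image inj])
  show "power_space n closure_of power_map n h ` topspace (power_space n) = topspace (power_space n)"
    unfolding topspace_power_space power_map_image_PiE
    by (simp add: power_space_def closure_of_product_topology closure_range)
qed

lemma stone_cech_power:
  "stone_cech_compactification TYPE('c) (power_space n :: (nat \<Rightarrow> 'a) topology)
     (power_space n :: (nat \<Rightarrow> 'b) topology) (power_map n h)"
  by (intro stone_cech_compactificationI compactification_power
      convergence_strategy_power[OF convergence_strategy_point])

end

section \<open>The half-long line: countable separation, bounds and suprema\<close>

section \<open>The half-long line\<close>

lemma half_long_line_le_iff:
  "x \<le> y \<longleftrightarrow> fst (Rep_half_long_line x) < fst (Rep_half_long_line y) \<or>
     fst (Rep_half_long_line x) = fst (Rep_half_long_line y) \<and>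
     snd (Rep_half_long_line x) \<le> snd (Rep_half_long_line y)"
  by transfer auto

lemma half_long_line_less_iff:
  "x < y \<longleftrightarrow> fst (Rep_half_long_line x) < fst (Rep_half_long_line y) \<or>
     fst (Rep_half_long_line x) = fst (Rep_half_long_line y) \<and>
     snd (Rep_half_long_line x) < snd (Rep_half_long_line y)"
  by transfer auto

lemma half_long_line_coord: "0 \<le> snd (Rep_half_long_line x)" "snd (Rep_half_long_line x) < 1"
  using Rep_half_long_line[of x] by (auto simp: mem_Times_iff)

lemma half_long_line_obtain:
  assumes "0 \<le> s" "s < 1"
  obtains x where "fst (Rep_half_long_line x) = \<alpha>" "snd (Rep_half_long_line x) = s"
proof (rule that)
  have "Rep_half_long_line (Abs_half_long_line (\<alpha>, s)) = (\<alpha>, s)"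
    using assms by (simp add: Abs_half_long_line_inverse)
  then show "fst (Rep_half_long_line (Abs_half_long_line (\<alpha>, s))) = \<alpha>"
      "snd (Rep_half_long_line (Abs_half_long_line (\<alpha>, s))) = s"
    by simp_all
qed

text \<open>\<open>D\<close> consists of the points with rational second coordinate whose ordinal is
  at most that of \<open>z\<close>; it is countable because an ordinal below \<Omega> has countably
  many predecessors. Just above \<open>z\<close> the ordinal is still that of \<open>z\<close>,
  since [0,1) has no largest element, so \<open>D\<close> separates on both sides.\<close>

lemma half_long_line_separating:
  "\<exists>D. countable D \<and> (\<forall>x<z. \<exists>d\<in>D. x < d \<and> d < z) \<and> (\<forall>x>z. \<exists>d\<in>D. z < d \<and> d < (x::half_long_line))"
proof -
  let ?R = Rep_half_long_line
  define D where "D = {d. fst (?R d) \<le> fst (?R z) \<and> snd (?R d) \<in> \<rat>}"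
  have "?R ` D \<subseteq> insert (fst (?R z)) {..<fst (?R z)} \<times> \<rat>"
    unfolding D_def by (clarsimp simp: image_subset_iff mem_Times_iff simp del: split_paired_All)
  moreover have "countable \<dots>"
    by (intro countable_SIGMA) (auto simp: countable_lessThan_ctbl_ord countable_rat)
  ultimately have "countable D"
    by (meson countable_image_inj_on countable_subset inj_onI Rep_half_long_line_inject)
  have gap: "\<exists>d\<in>D. fst (?R d) = \<alpha> \<and> a < snd (?R d) \<and> snd (?R d) < b"
    if "\<alpha> \<le> fst (?R z)" "0 \<le> a" "a < b" "b \<le> 1" for \<alpha> a b
  proof -
    obtain q where q: "q \<in> \<rat>" "a < q" "q < b" using Rats_dense_in_real[OF \<open>a < b\<close>] by blast
    have "0 \<le> q" "q < 1" using q that by simp_all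
    then obtain d where d: "fst (?R d) = \<alpha>" "snd (?R d) = q"
      by (rule half_long_line_obtain)
    with q that have "d \<in> D" by (simp add: D_def)
    with d q show ?thesis by blast
  qed
  have between: "\<exists>d\<in>D. x < d \<and> d < y" if xy: "x < y" and x: "fst (?R x) \<le> fst (?R z)" for x y
  proof -
    \<comment> \<open>The separating point keeps the ordinal of \<open>x\<close>. Its second
      coordinate must stay below that of \<open>y\<close> if \<open>y\<close> has the same ordinal,
      and below 1 otherwise.\<close>
    obtain t where t: "snd (?R x) < t" "t \<le> 1"
        "\<And>d. fst (?R d) = fst (?R x) \<Longrightarrow> snd (?R d) < t \<Longrightarrow> d < y"
    proof (cases "fst (?R x) = fst (?R y)")
      case True
      with xy half_long_line_coord[of y] show thesis
        by (intro that[of "snd (?R y)"]) (auto simp: half_long_line_less_iff)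
    next
      case False
      with xy half_long_line_coord[of x] show thesis
        by (intro that[of 1]) (auto simp: half_long_line_less_iff)
    qed
    obtain d where "d \<in> D" "fst (?R d) = fst (?R x)" "snd (?R x) < snd (?R d)" "snd (?R d) < t"
      using gap[OF x half_long_line_coord(1) t(1,2)] by blast
    then show ?thesis using t(3) by (intro bexI[of _ d]) (auto simp: half_long_line_less_iff)
  qed
  have "\<exists>d\<in>D. x < d \<and> d < z" if "x < z" for x
    using between[OF that] that by (auto simp: half_long_line_less_iff)
  moreover have "\<exists>d\<in>D. z < d \<and> d < x" if "z < x" for x
    using between[OF that] by simp
  ultimately show ?thesis using \<open>countable D\<close> by blast
qed

lemma half_long_line_dense: "\<exists>z. x < z \<and> z < y" if "x < y" for x y :: half_long_line
  using half_long_line_separating[of x] that by blast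

text \<open>If the ordinals occurring in \<open>C\<close> were unbounded, the uncountable set of all
  ordinals below \<Omega> would be a countable union of countable initial segments.\<close>

lemma half_long_line_countable_bounded:
  assumes "countable C"
  shows "\<exists>y. \<forall>x\<in>C. x < (y::half_long_line)"
proof -
  let ?R = Rep_half_long_line
  have "\<exists>\<beta>. \<forall>x\<in>C. fst (?R x) < \<beta>"
  proof (rule ccontr)
    assume "\<not> ?thesis"
    then have "UNIV = (\<Union>x\<in>C. insert (fst (?R x)) {..<fst (?R x)})"
      by (force simp: not_less le_less)
    moreover have "countable \<dots>"
      using assms by (intro countable_UN) (auto simp: countable_lessThan_ctbl_ord)
    ultimately show False using uncountable_UNIV_ctbl_ord by simp
  qed
  then obtain \<beta> where \<beta>: "\<forall>x\<in>C. fst (?R x) < \<beta>" by blast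
  obtain y where "fst (?R y) = \<beta>" using half_long_line_obtain[of 0 \<beta>] by auto
  with \<beta> show ?thesis by (auto simp: half_long_line_less_iff)
qed

lemma half_long_line_no_top: "\<exists>y. x < (y::half_long_line)"
  using half_long_line_countable_bounded[of "{x}"] by auto

text \<open>The supremum is found from above, as the least upper bound: first the least ordinal
  \<alpha> of an upper bound, then the infimum of the second coordinates over \<alpha>. This infimum
  stays in [0,1), whereas a supremum of coordinates of \<open>A\<close> could be 1.\<close>

lemma half_long_line_Sup:
  assumes "\<exists>u. \<forall>a\<in>A. a \<le> (u::half_long_line)"
  shows "\<exists>s. \<forall>b. s \<le> b \<longleftrightarrow> (\<forall>a\<in>A. a \<le> b)"
proof -
  let ?R = Rep_half_long_line
  define B where "B = {u. \<forall>a\<in>A. a \<le> u}"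
  define \<alpha> where "\<alpha> = (LEAST \<alpha>. \<exists>u\<in>B. fst (?R u) = \<alpha>)"
  have "\<exists>\<alpha>. \<exists>u\<in>B. fst (?R u) = \<alpha>" using assms by (simp add: B_def)
  then have "\<exists>u\<in>B. fst (?R u) = \<alpha>" unfolding \<alpha>_def by (rule LeastI_ex)
  then obtain u where u: "u \<in> B" "fst (?R u) = \<alpha>" by blast
  have \<alpha>_le: "\<alpha> \<le> fst (?R u)" if "u \<in> B" for u
    unfolding \<alpha>_def by (rule Least_le) (use that in blast)
  define T where "T = (\<lambda>u. snd (?R u)) ` {u\<in>B. fst (?R u) = \<alpha>}"
  have T: "T \<noteq> {}" "\<And>t. t \<in> T \<Longrightarrow> 0 \<le> t" "\<And>t. t \<in> T \<Longrightarrow> t < 1"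
    using u by (auto simp: T_def half_long_line_coord)
  then have bdd: "bdd_below T" by (intro bdd_belowI[of _ 0])
  have "0 \<le> Inf T" using T(1,2) by (rule cInf_greatest)
  moreover have "Inf T < 1"
  proof -
    obtain t where "t \<in> T" using T(1) by blast
    then show ?thesis using T(3) cInf_lower[OF _ bdd] le_less_trans by blast
  qed
  ultimately obtain s where s: "fst (?R s) = \<alpha>" "snd (?R s) = Inf T"
    by (rule half_long_line_obtain)
  have upper: "a \<le> s" if a: "a \<in> A" for a
  proof (cases "fst (?R a) = \<alpha>")
    case True
    have "snd (?R a) \<le> t" if t: "t \<in> T" for t
    proof -
      obtain v where v: "v \<in> B" "fst (?R v) = \<alpha>" "t = snd (?R v)"
        using t by (auto simp: T_def)
      then have "a \<le> v" using a by (simp add: B_def)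
      then show ?thesis using v True by (simp add: half_long_line_le_iff)
    qed
    then have "snd (?R a) \<le> Inf T" using T(1) by (intro cInf_greatest)
    then show ?thesis using s True by (simp add: half_long_line_le_iff)
  next
    case False
    have "a \<le> u" using u(1) a by (simp add: B_def)
    then show ?thesis using u(2) s(1) False by (simp add: half_long_line_le_iff)
  qed
  have least: "s \<le> b" if "b \<in> B" for b
  proof (cases "fst (?R b) = \<alpha>")
    case True
    then have "snd (?R b) \<in> T" using that by (simp add: T_def)
    then have "Inf T \<le> snd (?R b)" using bdd by (rule cInf_lower)
    then show ?thesis using s True by (simp add: half_long_line_le_iff)
  next
    case False
    then show ?thesis using \<alpha>_le[OF that] s(1) by (simp add: half_long_line_le_iff)
  qed
  show ?thesis
    by (rule Sup_existsI[OF upper least]) (auto simp: B_def)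
qed

lemma half_long_line_Inf:
  assumes "A \<noteq> {}"
  shows "\<exists>s. \<forall>b. b \<le> s \<longleftrightarrow> (\<forall>a\<in>A. b \<le> (a::half_long_line))"
proof -
  have "\<exists>u. \<forall>a\<in>{c. \<forall>a\<in>A. c \<le> a}. a \<le> u" using assms by auto
  from half_long_line_Sup[OF this]
  obtain s where s: "\<And>b. s \<le> b \<longleftrightarrow> (\<forall>a\<in>{c. \<forall>a\<in>A. c \<le> a}. a \<le> b)" by blast
  show ?thesis using Sup_lower_bounds_is_Inf[OF s] by blast
qed

section \<open>The extended half-long line as a completion\<close>

lemma ext_half_long_line_less_simps [simp]:
  "Half x < Half y \<longleftrightarrow> x < y" "Half x < Half_Omega" "\<not> Half_Omega < u"
  by (cases u; auto simp: less_ext_half_long_line_def)+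

lemma ext_half_long_line_Sup: "\<exists>s. \<forall>b. s \<le> b \<longleftrightarrow> (\<forall>a\<in>A. a \<le> (b::ext_half_long_line))"
proof (cases "\<exists>u. \<forall>a\<in>A. a \<le> Half u")
  case True
  then obtain u where u: "\<forall>a\<in>A. a \<le> Half u" by blast
  \<comment> \<open>The bound keeps \<open>Half_Omega\<close> out of \<open>A\<close>, so the
    supremum can be taken in the half-long line.\<close>
  then have A: "A = Half ` {x. Half x \<in> A}"
    by (auto simp: image_iff) (metis ext_half_long_line.exhaust less_eq_ext_half_long_line.simps(3))
  have "x \<le> u" if "Half x \<in> A" for x using u[rule_format, OF that] by simp
  then have "\<exists>u. \<forall>x\<in>{x. Half x \<in> A}. x \<le> u" by blast
  then obtain s where "\<And>b. s \<le> b \<longleftrightarrow> (\<forall>x\<in>{x. Half x \<in> A}. x \<le> b)"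
    using half_long_line_Sup by blast
  then have "Half s \<le> b \<longleftrightarrow> (\<forall>a\<in>A. a \<le> b)" for b
    by (subst A, cases b) auto
  then show ?thesis by blast
next
  case False
  then have "Half_Omega \<le> b \<longleftrightarrow> (\<forall>a\<in>A. a \<le> b)" for b by (cases b) auto
  then show ?thesis by blast
qed

lemma order_completion_Half: "order_completion Half"
proof
  fix b c :: ext_half_long_line
  show "Half x < Half y \<longleftrightarrow> x < y" for x y by simp
  show "b \<notin> range Half \<Longrightarrow> (\<forall>x. Half x < b) \<or> (\<forall>x. b < Half x)" by (cases b) auto
  show "\<exists>x. b < Half x \<and> Half x < c" if "b < c"
    using that half_long_line_dense half_long_line_no_top by (cases b; cases c) auto
  show "\<exists>s. \<forall>b. s \<le> b \<longleftrightarrow> (\<forall>a\<in>A. a \<le> b)" for A :: "ext_half_long_line set"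
    by (rule ext_half_long_line_Sup)
  show "\<exists>D. countable D \<and> (\<forall>x<z. \<exists>d\<in>D. x \<le> d \<and> d < z) \<and> (\<forall>x>z. \<exists>d\<in>D. z < d \<and> d \<le> x)"
    for z :: half_long_line
    using half_long_line_separating[of z] by (meson less_imp_le)
  show "\<exists>y. \<forall>x\<in>C. x \<le> y" if "countable C" for C :: "half_long_line set"
    using half_long_line_countable_bounded[OF that] by (meson less_imp_le)
  show "\<exists>y. \<forall>x\<in>C. y \<le> x" for C :: "half_long_line set"
    by (intro exI[of _ 0]) (simp add: zero_le_half_long_line)
qed

section \<open>The long line glued from two half-long lines, and its completion\<close>

section \<open>The long line\<close>

definition pos_long :: "half_long_line \<Rightarrow> long_line" where
  "pos_long x = abs_long_line (Inr x)"

definition neg_long :: "half_long_line \<Rightarrow> long_line" where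
  "neg_long x = abs_long_line (Inl x)"

lemma long_line_le_simps [simp]:
  "pos_long x \<le> pos_long y \<longleftrightarrow> x \<le> y"
  "neg_long x \<le> neg_long y \<longleftrightarrow> y \<le> x"
  "neg_long x \<le> pos_long y"
  "pos_long x \<le> neg_long y \<longleftrightarrow> x = 0 \<and> y = 0"
  by (simp_all add: pos_long_def neg_long_def less_eq_long_line.abs_eq)

lemma long_line_less_simps [simp]:
  "pos_long x < pos_long y \<longleftrightarrow> x < y"
  "neg_long x < neg_long y \<longleftrightarrow> y < x"
  "\<not> pos_long x < neg_long y"
  "neg_long x < pos_long y \<longleftrightarrow> x \<noteq> 0 \<or> y \<noteq> 0"
  by (auto simp: less_long_line_def less_le_not_le)

lemma neg_long_zero: "neg_long 0 = pos_long 0"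
  by (simp add: pos_long_def neg_long_def long_line.abs_eq_iff same_long_point_def)

text \<open>The origin has a name in both halves; requiring \<open>0 < x\<close> in the second case
  assigns it to the positive half.\<close>

lemma long_line_cases [case_names pos neg]:
  obtains x where "z = pos_long x" | x where "z = neg_long x" "0 < x"
proof -
  have "\<exists>p. z = abs_long_line p"
    by (induct z rule: long_line.abs_induct) blast
  then obtain p where "z = abs_long_line p" ..
  then have "(\<exists>x. z = pos_long x) \<or> (\<exists>x. z = neg_long x)"
    by (cases p) (auto simp: pos_long_def neg_long_def)
  then show thesis
    using that neg_long_zero by (metis zero_le_half_long_line order_le_less)
qed

lemma ext_long_line_less_simps [simp]:
  "Minus_Omega < Long x" "Minus_Omega < Plus_Omega" "Long x < Plus_Omega"
  "Long x < Long y \<longleftrightarrow> x < y" "\<not> u < Minus_Omega" "\<not> Plus_Omega < u"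
  by (cases u; auto simp: less_ext_long_line_def)+

text \<open>The highest layer that \<open>A\<close> meets decides. If \<open>A\<close> has no bound
  in the positive half, the supremum is \<open>Plus_Omega\<close>; if \<open>A\<close> meets the
  positive half, it is a supremum there; if \<open>A\<close> meets only the negative half, it is an
  infimum of the reversed coordinates; otherwise it is \<open>Minus_Omega\<close>.\<close>

lemma ext_long_line_Sup: "\<exists>s. \<forall>b. s \<le> b \<longleftrightarrow> (\<forall>a\<in>A. a \<le> (b::ext_long_line))"
proof -
  let ?P = "{x. Long (pos_long x) \<in> A}" and ?N = "{x. Long (neg_long x) \<in> A}"
  let ?bounded = "\<exists>u. \<forall>a\<in>A. a \<le> Long (pos_long u)"
  consider "\<not> ?bounded" | "?bounded" "?P \<noteq> {}" | "?bounded" "?P = {}" "?N \<noteq> {}"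
    | "?bounded" "?P = {}" "?N = {}"
    by satx
  then show ?thesis
  proof cases
    case 1
    show ?thesis
    proof (rule Sup_existsI)
      show "a \<le> Plus_Omega" for a by (cases a) simp_all
      show "Plus_Omega \<le> b" if b: "\<forall>a\<in>A. a \<le> b" for b
      proof (rule ccontr)
        assume not_top: "\<not> Plus_Omega \<le> b"
        \<comment> \<open>Bounds in the positive half are cofinal below \<open>Plus_Omega\<close>,
          so a smaller upper bound would contradict the case assumption.\<close>
        have "\<exists>u. b \<le> Long (pos_long u)"
        proof (cases b)
          case (Long z)
          then show ?thesis by (cases z rule: long_line_cases) auto
        qed (use not_top in simp_all)
        then obtain u where "b \<le> Long (pos_long u)" ..
        then have "\<forall>a\<in>A. a \<le> Long (pos_long u)" using b order_trans by blast
        with 1 show False by blast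
      qed
    qed
  next
    case 2
    then obtain u where u: "\<forall>a\<in>A. a \<le> Long (pos_long u)" by blast
    have "x \<le> u" if "Long (pos_long x) \<in> A" for x using u[rule_format, OF that] by simp
    then have "\<exists>u. \<forall>x\<in>?P. x \<le> u" by blast
    then obtain s where s: "\<And>b. s \<le> b \<longleftrightarrow> (\<forall>x\<in>?P. x \<le> b)" using half_long_line_Sup by blast
    obtain p where p: "Long (pos_long p) \<in> A" using 2(2) by blast
    show ?thesis
    proof (rule Sup_existsI)
      show "a \<le> Long (pos_long s)" if a: "a \<in> A" for a
      proof (cases a)
        case (Long z)
        show ?thesis
        proof (cases z rule: long_line_cases)
          case (pos y)
          then have "y \<in> ?P" using a Long by simp
          then have "y \<le> s" using s[THEN iffD1, OF order_refl] by blast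
          then show ?thesis using Long pos by simp
        qed (simp add: Long)
      next
        case Plus_Omega
        then show ?thesis using u[rule_format, OF a] by simp
      qed simp
      show "Long (pos_long s) \<le> b" if b: "\<forall>a\<in>A. a \<le> b" for b
      proof (cases b)
        case Minus_Omega
        then show ?thesis using b[rule_format, OF p] by simp
      next
        case (Long z)
        show ?thesis
        proof (cases z rule: long_line_cases)
          case (pos y)
          have "x \<le> y" if "x \<in> ?P" for x
            using b[rule_format, of "Long (pos_long x)"] that Long pos by simp
          then have "s \<le> y" unfolding s by blast
          then show ?thesis using Long pos by simp
        next
          case (neg y)
          then show ?thesis using b[rule_format, OF p] Long by simp
        qed
      qed simp
    qed
  next
    case 3
    then obtain u where u: "\<forall>a\<in>A. a \<le> Long (pos_long u)" by blast
    obtain s where s: "\<And>b. b \<le> s \<longleftrightarrow> (\<forall>x\<in>?N. b \<le> x)" using half_long_line_Inf[OF 3(3)] by blast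
    obtain p where p: "Long (neg_long p) \<in> A" using 3(3) by blast
    show ?thesis
    proof (rule Sup_existsI)
      show "a \<le> Long (neg_long s)" if a: "a \<in> A" for a
      proof (cases a)
        case (Long z)
        show ?thesis
        proof (cases z rule: long_line_cases)
          case (pos y)
          then show ?thesis using a Long 3(2) by simp
        next
          case (neg y)
          then have "y \<in> ?N" using a Long by simp
          then have "s \<le> y" using s[THEN iffD1, OF order_refl] by blast
          then show ?thesis using Long neg by simp
        qed
      next
        case Plus_Omega
        then show ?thesis using u[rule_format, OF a] by simp
      qed simp
      show "Long (neg_long s) \<le> b" if b: "\<forall>a\<in>A. a \<le> b" for b
      proof (cases b)
        case Minus_Omega
        then show ?thesis using b[rule_format, OF p] by simp
      next
        case (Long z)
        show ?thesis
        proof (cases z rule: long_line_cases)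
          case (neg y)
          have "y \<le> x" if "x \<in> ?N" for x
            using b[rule_format, of "Long (neg_long x)"] that Long neg by simp
          then have "y \<le> s" unfolding s by blast
          then show ?thesis using Long neg by simp
        qed (simp add: Long)
      qed simp
    qed
  next
    case 4
    then obtain u where u: "\<forall>a\<in>A. a \<le> Long (pos_long u)" by blast
    have bot: "a = Minus_Omega" if a: "a \<in> A" for a
    proof (cases a)
      case (Long z)
      then show ?thesis using a 4(2,3) by (cases z rule: long_line_cases) simp_all
    next
      case Plus_Omega
      then show ?thesis using u[rule_format, OF a] by simp
    qed
    show ?thesis by (rule Sup_existsI[of _ Minus_Omega]) (auto dest: bot)
  qed
qed

text \<open>With \<open>w\<close> the distance of \<open>z\<close> from the origin, the separating
  set for \<open>w\<close> together with its mirror image works for \<open>z\<close>.\<close>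

lemma long_line_separating:
  "\<exists>D. countable D \<and> (\<forall>x<z. \<exists>d\<in>D. x < d \<and> d < z) \<and> (\<forall>x>z. \<exists>d\<in>D. z < d \<and> d < (x::long_line))"
proof -
  obtain w where w: "z = pos_long w \<or> z = neg_long w" by (cases z rule: long_line_cases) auto
  obtain D where D: "countable D" "\<And>x. x < w \<Longrightarrow> \<exists>d\<in>D. x < d \<and> d < w"
      "\<And>x. w < x \<Longrightarrow> \<exists>d\<in>D. w < d \<and> d < x"
    using half_long_line_separating[of w] by blast
  have zero_less: "(0::half_long_line) < x \<longleftrightarrow> x \<noteq> 0" for x
    using zero_le_half_long_line[of x] by auto
  let ?D = "pos_long ` D \<union> neg_long ` D"
  have "\<exists>d\<in>?D. x < d \<and> d < z" if xz: "x < z" for x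
    using w
  proof (elim disjE)
    assume z: "z = pos_long w"
    show ?thesis
    proof (cases x rule: long_line_cases)
      case (pos y)
      then show ?thesis using D(2)[of y] xz z by (auto simp: bex_Un)
    next
      case (neg y)
      show ?thesis
      \<comment> \<open>Here \<open>x\<close> is negative and \<open>z\<close> is not. If
        \<open>z\<close> is the origin, the point comes from the mirrored part, between
        \<open>x\<close> and the origin; otherwise it comes from \<open>D\<close>, between 0 and
        \<open>w\<close>.\<close>
      proof (cases "w = 0")
        case True
        then show ?thesis using D(3)[of y] neg z zero_less by (auto simp: bex_Un)
      next
        case False
        then show ?thesis using D(2)[of 0] neg z zero_less by (auto simp: bex_Un)
      qed
    qed
  next
    assume z: "z = neg_long w"
    then obtain y where y: "x = neg_long y" "w < y"
      using xz by (cases x rule: long_line_cases) auto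
    then show ?thesis using D(3)[of y] z by (auto simp: bex_Un)
  qed
  moreover have "\<exists>d\<in>?D. z < d \<and> d < x" if zx: "z < x" for x
    using w
  proof (elim disjE)
    assume z: "z = pos_long w"
    then obtain y where y: "x = pos_long y" "w < y"
      using zx by (cases x rule: long_line_cases) auto
    then show ?thesis using D(3)[of y] z by (auto simp: bex_Un)
  next
    assume z: "z = neg_long w"
    show ?thesis
    proof (cases x rule: long_line_cases)
      case (neg y)
      then show ?thesis using D(2)[of y] zx z by (auto simp: bex_Un)
    next
      case (pos y)
      show ?thesis
      proof (cases "w = 0")
        case True
        then show ?thesis using D(3)[of y] pos zx z zero_less by (auto simp: bex_Un)
      next
        case False
        then show ?thesis using D(2)[of 0] pos z zero_less by (auto simp: bex_Un)
      qed
    qed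
  qed
  moreover have "countable ?D" using D(1) by simp
  ultimately show ?thesis by blast
qed

lemma long_line_countable_bounded:
  assumes "countable C"
  shows "\<exists>y. \<forall>x\<in>C. x < (y::long_line)" "\<exists>y. \<forall>x\<in>C. (y::long_line) < x"
proof -
  have "inj pos_long" "inj neg_long"
    by (auto intro!: injI simp: order.eq_iff[where 'a = long_line])
  then have "countable (pos_long -` C)" "countable (neg_long -` C)"
    using assms by (auto intro!: countable_image_inj_on[OF countable_subset[OF image_vimage_subset]]
        intro: inj_on_subset)
  then obtain u v where u: "\<forall>x\<in>pos_long -` C. x < u" and v: "\<forall>x\<in>neg_long -` C. x < v"
    using half_long_line_countable_bounded by meson
  \<comment> \<open>Taking the maximum with 0 makes \<open>v'\<close> positive, so that
    \<open>neg_long v'\<close> lies strictly below the origin as well.\<close>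
  obtain u' v' where "max 0 u < u'" "max 0 v < v'" using half_long_line_no_top by meson
  then have *: "u < u'" "v < v'" "0 < u'" "0 < v'" by auto
  have "x < pos_long u'" if "x \<in> C" for x
    using u that * by (cases x rule: long_line_cases) (auto intro: less_trans)
  then show "\<exists>y. \<forall>x\<in>C. x < y" by blast
  have "neg_long v' < x" if "x \<in> C" for x
    using v that * by (cases x rule: long_line_cases) (auto intro: less_trans)
  then show "\<exists>y. \<forall>x\<in>C. y < x" by blast
qed

lemma order_completion_Long: "order_completion Long"
proof
  fix b c :: ext_long_line
  show "Long x < Long y \<longleftrightarrow> x < y" for x y by simp
  show "b \<notin> range Long \<Longrightarrow> (\<forall>x. Long x < b) \<or> (\<forall>x. b < Long x)" by (cases b) auto
  show "\<exists>x. b < Long x \<and> Long x < c" if "b < c"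
  proof -
    have "\<exists>y. x < y" "\<exists>y. y < x" for x :: long_line
      using long_line_countable_bounded[of "{x}"] by auto
    moreover have "\<exists>z. x < z \<and> z < y" if "x < y" for x y :: long_line
      using long_line_separating[of x] that by blast
    ultimately show ?thesis using that by (cases b; cases c) auto
  qed
  show "\<exists>s. \<forall>b. s \<le> b \<longleftrightarrow> (\<forall>a\<in>A. a \<le> b)" for A :: "ext_long_line set"
    by (rule ext_long_line_Sup)
  show "\<exists>D. countable D \<and> (\<forall>x<z. \<exists>d\<in>D. x \<le> d \<and> d < z) \<and> (\<forall>x>z. \<exists>d\<in>D. z < d \<and> d \<le> x)"
    for z :: long_line
    using long_line_separating[of z] by (meson less_imp_le)
  show "\<exists>y. \<forall>x\<in>C. x \<le> y" "\<exists>y. \<forall>x\<in>C. y \<le> x" if "countable C" for C :: "long_line set"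
    using long_line_countable_bounded[OF that] by (meson less_imp_le)+
qed

theorem theorem1p1:
  fixes n :: nat
  assumes "n \<ge> 1"
  shows "stone_cech_compactification TYPE('c)
           (power_space n :: (nat \<Rightarrow> half_long_line) topology)
           (power_space n :: (nat \<Rightarrow> ext_half_long_line) topology)
           (power_map n Half) \<and>
         stone_cech_compactification TYPE('c)
           (power_space n :: (nat \<Rightarrow> long_line) topology)
           (power_space n :: (nat \<Rightarrow> ext_long_line) topology)
           (power_map n Long)"
  by (intro conjI order_completion.stone_cech_power order_completion_Half order_completion_Long)

end
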